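(* Let $\mathcal{C}$ be a $d$-dimensional shellable simplicial complex, and let $r>d$ be an integer. Then the $h$-polynomial $h(\mathcal{C}^{\langle r\rangle};x)$ of the $r$-th edgewise subdivision of $\mathcal{C}$ is real-rooted.
   Context: Edgewise subdivision: let $\Delta=\mathrm{conv}(e^{(1)},\ldots,e^{(n)})\subset\mathbb{R}^n$ be the $(n-1)$-dimensional standard simplex. For $x\in\mathbb{Z}^n$ let $\mathrm{supp}(x)=\{i:x_i\ne0\}$, and let $\iota(x)=(x_1,x_1+x_2,\ldots,x_1+\cdots+x_n)$. For $r\ge1$, the $r$-th edgewise subdivision $\Delta^{\langle r\rangle}$ is the simplicial complex with vertex set $r\Delta\cap\mathbb{Z}^n$ in which $F\subset r\Delta\cap\mathbb{Z}^n$ is a face if and only if $\bigcup_{x\in F}\mathrm{supp}(x)$ is a face of $\Delta$ and, for all $x,y\in F$, $\iota(x)-\iota(y)\in\{0,1\}^n$ or $\iota(y)-\iota(x)\in\{0,1\}^n$. For a simplicial complex $\mathcal{C}$, $\mathcal{C}^{\langle r\rangle}$ is obtained by gluing together the $r$-th edgewise subdivisions of its facets (the vertices of each facet being ordered according to a fixed total order on the vertices of $\mathcal{C}$, so that the subdivisions agree on common faces). A shelling of a pure $d$-dimensional complex is a linear ordering $(F_1,\ldots,F_s)$ of its facets such that either $d=0$, or (1) the boundary complex of $F_1$ has a shelling, and (2) for $2\le j\le s$, $F_j\cap\bigcup_{i<j}F_i$ is nonempty and equals $G_1\cup\cdots\cup G_m$ for some shelling $(G_1,\ldots,G_m,\ldots,G_t)$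 of the boundary complex of $F_j$ and some $m\in[t]$. A complex is shellable if it is pure and admits a shelling. For an $(m-1)$-dimensional complex $\mathcal{K}$, $f(\mathcal{K};x)=\sum_{k=-1}^{m-1}f_k(\mathcal{K})x^{k+1}$, where $f_k$ is the number of $k$-dimensional faces ($f_{-1}=1$), and $h(\mathcal{K};x)=(1-x)^m f(\mathcal{K};\frac{x}{1-x})$. A real polynomial is real-rooted if it is identically zero or has only real zeros. *)

theory Defs
  imports Complex_Main "HOL-Computational_Algebra.Polynomial"
begin

text \<open>A finite abstract simplicial complex is the set of its faces; the empty face is included.\<close>

definition simplicial_complex :: "'v set set \<Rightarrow> bool" where
  "simplicial_complex K \<longleftrightarrow>
     finite K \<and> {} \<in> K \<and> (\<forall>F\<in>K. finite F) \<and> (\<forall>F\<in>K. \<forall>G. G \<subseteq> F \<longrightarrow> G \<in> K)"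

definition facets :: "'v set set \<Rightarrow> 'v set set" where
  "facets K = {F \<in> K. \<forall>G\<in>K. F \<subseteq> G \<longrightarrow> G = F}"

definition complex_dim :: "'v set set \<Rightarrow> int" where
  "complex_dim K = int (Max (card ` K)) - 1"

definition pure_complex :: "'v set set \<Rightarrow> bool" where
  "pure_complex K \<longleftrightarrow> (\<forall>F\<in>facets K. int (card F) - 1 = complex_dim K)"

definition boundary_complex :: "'v set \<Rightarrow> 'v set set" where
  "boundary_complex F = Pow F - {F}"

text \<open>The first argument is the dimension of the (pure) complex.  A face \<open>F\<close>, regarded as a
  subcomplex, is \<open>Pow F\<close>.  Such subcomplexes always share the empty face, so that the geometric
  intersection is nonempty iff the intersection of the subcomplexes contains another face.
  List positions start at \<open>0\<close>.\<close>

fun shelling :: "nat \<Rightarrow> 'v set set \<Rightarrow> 'v set list \<Rightarrow> bool" where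
  "shelling 0 K Fs \<longleftrightarrow> distinct Fs \<and> set Fs = facets K"
| "shelling (Suc d) K Fs \<longleftrightarrow>
     distinct Fs \<and> set Fs = facets K \<and>
     (\<exists>Gs. shelling d (boundary_complex (Fs ! 0)) Gs) \<and>
     (\<forall>j. 1 \<le> j \<and> j < length Fs \<longrightarrow>
        Pow (Fs ! j) \<inter> (\<Union>i<j. Pow (Fs ! i)) - {{}} \<noteq> {} \<and>
        (\<exists>Gs m. shelling d (boundary_complex (Fs ! j)) Gs \<and> 1 \<le> m \<and> m \<le> length Gs \<and>
           Pow (Fs ! j) \<inter> (\<Union>i<j. Pow (Fs ! i)) = (\<Union>k<m. Pow (Gs ! k))))"

definition shellable :: "'v set set \<Rightarrow> bool" where
  "shellable K \<longleftrightarrow>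
     pure_complex K \<and> (\<exists>d. complex_dim K = int d \<and> (\<exists>Fs. shelling d K Fs))"

text \<open>The simplex on a finite vertex set \<open>V\<close>, linearly ordered by the order of the vertex type,
  plays the role of the standard simplex on \<open>e\<^sup>1, \<dots>, e\<^sup>n\<close>.  A lattice point
  of its \<open>r\<close>-th dilation is the function of its coordinates, extended by zero outside \<open>V\<close>;
  hence lattice points on a common face of two simplices are literally equal.\<close>

definition lattice_points :: "'v set \<Rightarrow> nat \<Rightarrow> ('v \<Rightarrow> int) set" where
  "lattice_points V r =
     {x. (\<forall>i\<in>V. 0 \<le> x i) \<and> (\<Sum>i\<in>V. x i) = int r \<and> (\<forall>i. i \<notin> V \<longrightarrow> x i = 0)}"

definition supp :: "('v \<Rightarrow> int) \<Rightarrow> 'v set" where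
  "supp x = {i. x i \<noteq> 0}"

definition iota :: "'v::linorder set \<Rightarrow> ('v \<Rightarrow> int) \<Rightarrow> 'v \<Rightarrow> int" where
  "iota V x i = (\<Sum>j\<in>{j\<in>V. j \<le> i}. x j)"

definition edgewise_simplex :: "'v::linorder set \<Rightarrow> nat \<Rightarrow> ('v \<Rightarrow> int) set set" where
  "edgewise_simplex V r =
     {F. F \<subseteq> lattice_points V r \<and> (\<Union>x\<in>F. supp x) \<in> Pow V \<and>
         (\<forall>x\<in>F. \<forall>y\<in>F. (\<forall>i\<in>V. iota V x i - iota V y i \<in> {0, 1}) \<or>
                       (\<forall>i\<in>V. iota V y i - iota V x i \<in> {0, 1}))}"

definition edgewise_subdivision :: "'v::linorder set set \<Rightarrow> nat \<Rightarrow> ('v \<Rightarrow> int) set set" where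
  "edgewise_subdivision K r = (\<Union>V\<in>facets K. edgewise_simplex V r)"

text \<open>The union above is the gluing: the subdivision of a simplex restricts to the subdivision
  of each of its faces.\<close>

lemma iota_face:
  assumes "finite V" "U \<subseteq> V" "supp x \<subseteq> U"
  shows "iota V x i = iota U x i"
  unfolding iota_def
  by (rule sum.mono_neutral_right) (use assms in \<open>auto simp: supp_def\<close>)

lemma iota_face_cases:
  assumes "finite U"
  shows "(\<forall>x. iota U x i = 0) \<or> (\<exists>k\<in>U. \<forall>x. iota U x i = iota U x k)"
proof (cases "{j\<in>U. j \<le> i} = {}")
  case True
  then show ?thesis unfolding iota_def by (metis sum.empty)
next
  case False
  define k where "k = Max {j\<in>U. j \<le> i}"
  have k: "k \<in> {j\<in>U. j \<le> i}"
    unfolding k_def using False assms by (intro Max_in) auto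
  have "j \<le> k" if "j \<in> U" "j \<le> i" for j
    unfolding k_def using that assms by (intro Max_ge) auto
  then have "{j\<in>U. j \<le> i} = {j\<in>U. j \<le> k}" using k by auto
  then show ?thesis using k unfolding iota_def by auto
qed

lemma edgewise_simplex_face:
  fixes U V :: "'v::linorder set"
  assumes "finite V" "U \<subseteq> V"
  shows "{F \<in> edgewise_simplex V r. (\<Union>x\<in>F. supp x) \<subseteq> U} = edgewise_simplex U r"
proof -
  have fU: "finite U" using assms finite_subset by blast
  have pts: "x \<in> lattice_points V r \<and> supp x \<subseteq> U \<longleftrightarrow> x \<in> lattice_points U r" for x
  proof -
    have "supp x \<subseteq> U \<Longrightarrow> (\<Sum>i\<in>V. x i) = (\<Sum>i\<in>U. x i)"
      by (rule sum.mono_neutral_right) (use assms in \<open>auto simp: supp_def\<close>)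
    moreover have "x \<in> lattice_points U r \<Longrightarrow> supp x \<subseteq> U"
      by (auto simp: lattice_points_def supp_def)
    moreover have "x \<in> lattice_points V r \<longleftrightarrow> x \<in> lattice_points U r"
      if "supp x \<subseteq> U" "(\<Sum>i\<in>V. x i) = (\<Sum>i\<in>U. x i)"
    proof -
      have "x i = 0" if "i \<notin> U" for i using \<open>supp x \<subseteq> U\<close> that by (auto simp: supp_def)
      then have "(\<forall>i\<in>V. 0 \<le> x i) \<longleftrightarrow> (\<forall>i\<in>U. 0 \<le> x i)"
        "\<forall>i. i \<notin> V \<longrightarrow> x i = 0" "\<forall>i. i \<notin> U \<longrightarrow> x i = 0"
        using assms(2) by (force, blast+)
      then show ?thesis unfolding lattice_points_def using that(2) by simp
    qed
    ultimately show ?thesis by blast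
  qed
  have cmp: "(\<forall>i\<in>V. iota V x i - iota V y i \<in> {0, 1}) \<longleftrightarrow>
             (\<forall>i\<in>U. iota U x i - iota U y i \<in> {0, 1})"
    if "supp x \<subseteq> U" "supp y \<subseteq> U" for x y
  proof -
    have "iota V x i = iota U x i" "iota V y i = iota U y i" for i
      using iota_face assms that by blast+
    moreover have "iota U x i - iota U y i \<in> {0, 1}"
      if "\<forall>i\<in>U. iota U x i - iota U y i \<in> {0, 1}" for i
      using iota_face_cases[OF fU, of i]
    proof
      assume "\<forall>x. iota U x i = 0"
      then show ?thesis by simp
    next
      assume "\<exists>k\<in>U. \<forall>x. iota U x i = iota U x k"
      then obtain k where k: "k \<in> U" and eq: "\<And>x. iota U x i = iota U x k" by blast
      show ?thesis unfolding eq[of x] eq[of y] using that k by (rule bspec)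
    qed
    ultimately show ?thesis using assms(2) by (simp only:) blast
  qed
  define P where "P W x y \<longleftrightarrow> (\<forall>i\<in>W. iota W x i - iota W y i \<in> {0, 1})" for W :: "'v set" and x y
  have sd: "F \<in> edgewise_simplex W r \<longleftrightarrow> F \<subseteq> lattice_points W r \<and>
      (\<Union>x\<in>F. supp x) \<subseteq> W \<and> (\<forall>x\<in>F. \<forall>y\<in>F. P W x y \<or> P W y x)" for F and W :: "'v set"
    unfolding edgewise_simplex_def P_def by simp
  have P: "P V x y \<longleftrightarrow> P U x y" if "supp x \<subseteq> U" "supp y \<subseteq> U" for x y
    unfolding P_def using cmp that .
  have "F \<in> edgewise_simplex V r \<and> (\<Union>x\<in>F. supp x) \<subseteq> U \<longleftrightarrow> F \<in> edgewise_simplex U r" for F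
  proof (cases "(\<Union>x\<in>F. supp x) \<subseteq> U")
    case True
    then have sF: "supp x \<subseteq> U" if "x \<in> F" for x using that by blast
    have "F \<subseteq> lattice_points V r \<longleftrightarrow> F \<subseteq> lattice_points U r"
      using pts sF by blast
    moreover have "(\<forall>x\<in>F. \<forall>y\<in>F. P V x y \<or> P V y x) \<longleftrightarrow> (\<forall>x\<in>F. \<forall>y\<in>F. P U x y \<or> P U y x)"
      using P sF by simp
    moreover have "(\<Union>x\<in>F. supp x) \<subseteq> V" using True assms(2) by (rule order_trans)
    ultimately show ?thesis using True unfolding sd by simp
  next
    case False
    then show ?thesis unfolding sd by simp
  qed
  then show ?thesis by blast
qed

definition face_number :: "'v set set \<Rightarrow> int \<Rightarrow> nat" where
  "face_number K k = card {F \<in> K. int (card F) - 1 = k}"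

definition f_polynomial :: "'v set set \<Rightarrow> real poly" where
  "f_polynomial K =
     (\<Sum>i\<le>nat (complex_dim K + 1). monom (of_nat (face_number K (int i - 1))) i)"

text \<open>\<open>(1 - x)\<^sup>m f(x / (1 - x))\<close> with \<open>m = dim K + 1\<close>, denominators cleared so that it is
  a polynomial; see \<open>poly_h_polynomial\<close>.\<close>

definition h_polynomial :: "'v set set \<Rightarrow> real poly" where
  "h_polynomial K =
     (\<Sum>i\<le>nat (complex_dim K + 1).
        smult (coeff (f_polynomial K) i)
          ([:0, 1:] ^ i * [:1, -1:] ^ (nat (complex_dim K + 1) - i)))"

lemma degree_f_polynomial: "degree (f_polynomial K) \<le> nat (complex_dim K + 1)"
  unfolding f_polynomial_def
  by (intro degree_sum_le) (auto intro: order_trans[OF degree_monom_le])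

lemma poly_h_polynomial:
  assumes "x \<noteq> 1"
  shows "poly (h_polynomial K) x =
         (1 - x) ^ nat (complex_dim K + 1) * poly (f_polynomial K) (x / (1 - x))"
proof -
  let ?m = "nat (complex_dim K + 1)"
  have *: "x ^ i * (1 - x) ^ (?m - i) = (1 - x) ^ ?m * (x / (1 - x)) ^ i" if "i \<le> ?m" for i
    using assms that by (simp add: power_divide power_diff)
  have "poly (h_polynomial K) x =
        (\<Sum>i\<le>?m. coeff (f_polynomial K) i * (x ^ i * (1 - x) ^ (?m - i)))"
    by (simp add: h_polynomial_def poly_sum)
  also have "\<dots> = (\<Sum>i\<le>?m. (1 - x) ^ ?m * (coeff (f_polynomial K) i * (x / (1 - x)) ^ i))"
    by (intro sum.cong refl) (simp add: *)
  also have "\<dots> = (1 - x) ^ ?m * poly (f_polynomial K) (x / (1 - x))"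
    unfolding poly_altdef sum_distrib_left using degree_f_polynomial[of K]
    by (intro sum.mono_neutral_right) (auto simp: coeff_eq_0)
  finally show ?thesis .
qed

definition real_rooted :: "real poly \<Rightarrow> bool" where
  "real_rooted p \<longleftrightarrow>
     p = 0 \<or> (\<forall>z::complex. poly (map_poly complex_of_real p) z = 0 \<longrightarrow> z \<in> \<real>)"

end

theory Submission
  imports Defs "HOL-Computational_Algebra.Polynomial_FPS" "HOL-Library.Disjoint_Sets"
begin

text \<open>For a complex \<open>K\<close> let \<open>H(K, n)\<close> be the number of monomials of degree \<open>n\<close> whose support is a
  face of \<open>K\<close>, so that \<open>\<Sum> H(K, n) X\<^sup>n = h(K) / (1 - X)\<^bsup>dim K + 1\<^esup>\<close>.  Every lattice point of
  the dilation \<open>n r \<Delta>\<close> is, in a unique way, a sum of \<open>n\<close> lattice points of \<open>r \<Delta>\<close> spanning a face of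
  the edgewise subdivision; hence \<open>H(C\<^bsup>(r)\<^esup>, n) = H(C, r n)\<close>.  A shelling partitions \<open>C\<close> into
  intervals \<open>[R\<^sub>j, F\<^sub>j]\<close>, which gives \<open>h(C) = \<Sum> X\<^bsup>|R\<^sub>j|\<^esup>\<close>.  Therefore \<open>h(C\<^bsup>(r)\<^esup>)\<close> is
  the sum over \<open>j\<close> of one term \<open>u\<^bsub>r - 1 + |R\<^sub>j|\<^esub>\<close> of a sequence \<open>u\<close> of polynomials, obtained from the
  residue classes modulo \<open>r\<close> of the exponents of \<open>(1 + X + \<dots> + X\<^bsup>r - 1\<^esup>)\<^bsup>d + 1\<^esup>\<close>.

  At a point \<open>z\<close> of the open upper half plane this sequence turns counterclockwise, by the
  angle \<open>arg z < \<pi>\<close> in \<open>r\<close> steps.  As \<open>|R\<^sub>j| \<le> d + 1 \<le> r\<close>, all terms lie in a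
  common cone of angle less than \<open>\<pi>\<close>, so their sum is not zero.\<close>

section \<open>Sequences turning in the upper half plane\<close>

text \<open>The signed area spanned by \<open>a\<close> and \<open>b\<close>. It is nonnegative when
  \<open>b\<close> arises from \<open>a\<close> by a counterclockwise turn of at most
  \<open>\<pi>\<close> and a nonnegative scaling.\<close>

definition cross :: "complex \<Rightarrow> complex \<Rightarrow> real" where
  "cross a b = Im (cnj a * b)"

lemma cross_add_left: "cross (a + a') b = cross a b + cross a' b"
  by (simp add: cross_def algebra_simps)

lemma cross_add_right: "cross a (b + b') = cross a b + cross a b'"
  by (simp add: cross_def algebra_simps)

lemma cross_sum_left: "cross (\<Sum>i\<in>A. f i) b = (\<Sum>i\<in>A. cross (f i) b)"
  by (simp add: cross_def sum_distrib_right)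

lemma cross_sum_right: "cross a (\<Sum>i\<in>A. f i) = (\<Sum>i\<in>A. cross a (f i))"
  by (simp add: cross_def sum_distrib_left)

lemma cross_self [simp]: "cross a a = 0"
  by (simp add: cross_def)

lemma cross_mult_self: "cross a (z * a) = Im z * (cmod a)\<^sup>2"
  by (simp add: cross_def cmod_power2 algebra_simps power2_eq_square[of "Re a"] power2_eq_square[of "Im a"])

text \<open>The range \<open>j \<le> i + r\<close> is one full period, ending with the comparison of
  \<open>u i\<close> and \<open>z * u i\<close>.\<close>

definition turning :: "nat \<Rightarrow> complex \<Rightarrow> (nat \<Rightarrow> complex) \<Rightarrow> bool" where
  "turning r z u \<longleftrightarrow> (\<forall>i. u (i + r) = z * u i) \<and>
     (\<forall>i j. i \<le> j \<and> j \<le> i + r \<longrightarrow> 0 \<le> cross (u i) (u j))"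

lemma turningD:
  assumes "turning r z u"
  shows "u (i + r) = z * u i" "i \<le> j \<Longrightarrow> j \<le> i + r \<Longrightarrow> 0 \<le> cross (u i) (u j)"
  using assms by (auto simp: turning_def)

text \<open>The windows starting at \<open>i\<close> and at \<open>j\<close> are \<open>a + b\<close> and \<open>b + z * a\<close>, where \<open>b\<close> is the sum over
  their overlap.\<close>

lemma turning_window:
  assumes u: "turning r z u" and z: "0 \<le> Im z"
  shows "turning r z (\<lambda>i. \<Sum>j<r. u (i + j))"
proof -
  have window: "(\<Sum>j<r. u (i + j)) = sum u {i..<i + r}" for i
    using sum.shift_bounds_nat_ivl[of u 0 i r] by (simp add: add.commute lessThan_atLeast0)
  have shift: "sum u {i + r..<j + r} = z * sum u {i..<j}" for i j
    by (simp add: sum.shift_bounds_nat_ivl turningD(1)[OF u] sum_distrib_left)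
  have "0 \<le> cross (sum u {i..<i + r}) (sum u {j..<j + r})" if ij: "i \<le> j" "j \<le> i + r" for i j
  proof -
    define a b where "a = sum u {i..<j}" and "b = sum u {j..<i + r}"
    have "sum u {i..<i + r} = a + b"
      unfolding a_def b_def using ij by (simp add: sum.atLeastLessThan_concat)
    moreover have "sum u {j..<j + r} = b + z * a"
      unfolding a_def b_def shift[symmetric] using ij by (simp add: sum.atLeastLessThan_concat)
    moreover have "0 \<le> cross a b"
      unfolding a_def b_def cross_sum_left cross_sum_right
      by (intro sum_nonneg turningD(2)[OF u]) auto
    moreover have "0 \<le> cross b (z * a)"
      unfolding a_def b_def shift[symmetric] cross_sum_left cross_sum_right
      by (intro sum_nonneg turningD(2)[OF u]) auto
    moreover have "0 \<le> cross a (z * a)"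
      using z by (simp add: cross_mult_self)
    ultimately show ?thesis
      by (simp add: cross_add_left cross_add_right)
  qed
  moreover have "sum u {i + r..<i + r + r} = z * sum u {i..<i + r}" for i
    by (rule shift)
  ultimately show ?thesis
    unfolding turning_def window by blast
qed

text \<open>All terms lie in the cone spanned by \<open>u b\<close> and \<open>z * u b\<close>; a vanishing sum would make each of
  them a positive multiple of \<open>u b\<close>.\<close>

lemma turning_sum_nonzero:
  assumes u: "turning r z u" and nz: "\<And>i. u i \<noteq> 0" and z: "0 < Im z"
    and J: "finite J" "J \<noteq> {}" "\<And>j. j \<in> J \<Longrightarrow> b \<le> e j \<and> e j \<le> b + r"
  shows "(\<Sum>j\<in>J. u (e j)) \<noteq> 0"
proof
  assume "(\<Sum>j\<in>J. u (e j)) = 0"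
  then have "(\<Sum>j\<in>J. cross (u b) (u (e j))) = 0"
    unfolding cross_sum_right[symmetric] by (simp add: cross_def)
  then have par: "cross (u b) (u (e j)) = 0" if "j \<in> J" for j
    using that J turningD(2)[OF u] by (simp add: sum_nonneg_eq_0_iff)
  define c where "c j = Re (u (e j) / u b)" for j
  have c: "u (e j) = complex_of_real (c j) * u b" if "j \<in> J" for j
  proof -
    have "Im (u (e j) / u b) = 0"
      using par[OF that] by (simp add: Im_divide cross_def algebra_simps)
    then have "u (e j) / u b = complex_of_real (c j)"
      by (simp add: c_def complex_eq_iff)
    then show ?thesis using nz[of b] by (simp add: field_simps)
  qed
  \<comment> \<open>Comparison with the far end \<open>u (b + r) = z * u b\<close> of the cone rules
    out a negative multiple of \<open>u b\<close>.\<close>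
  have "0 < c j" if j: "j \<in> J" for j
  proof -
    have "0 \<le> cross (u (e j)) (u (b + r))"
      using J(3)[OF j] by (intro turningD(2)[OF u]) auto
    also have "\<dots> = c j * (Im z * (cmod (u b))\<^sup>2)"
      unfolding turningD(1)[OF u] c[OF j] cross_mult_self[symmetric]
      by (simp add: cross_def algebra_simps)
    finally have "0 \<le> c j"
      using mult_pos_pos[OF z, of "(cmod (u b))\<^sup>2"] nz[of b] by (simp add: zero_le_mult_iff)
    moreover have "c j \<noteq> 0" using c[OF j] nz[of "e j"] by auto
    ultimately show ?thesis by simp
  qed
  then have "0 < sum c J" using J by (intro sum_pos) auto
  moreover have "(\<Sum>j\<in>J. u (e j)) = complex_of_real (sum c J) * u b"
    using c by (simp add: sum_distrib_right)
  ultimately show False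
    using \<open>(\<Sum>j\<in>J. u (e j)) = 0\<close> nz[of b] by (simp del: of_real_sum)
qed

text \<open>The image of \<open>X ^ i * (1 + X + ... + X ^ (r - 1)) ^ n\<close> under the linear map
  that sends \<open>X ^ k\<close> to \<open>X ^ (k div r)\<close>.\<close>

fun window_poly :: "nat \<Rightarrow> nat \<Rightarrow> nat \<Rightarrow> real poly" where
  "window_poly r 0 i = monom 1 (i div r)"
| "window_poly r (Suc n) i = (\<Sum>j<r. window_poly r n (i + j))"

section \<open>Evaluation of real polynomials at complex points\<close>

abbreviation cpoly :: "real poly \<Rightarrow> complex \<Rightarrow> complex" where
  "cpoly p \<equiv> poly (map_poly complex_of_real p)"

lemma cpoly_add: "cpoly (p + q) z = cpoly p z + cpoly q z"
proof -
  have "map_poly complex_of_real (p + q) = map_poly complex_of_real p + map_poly complex_of_real q"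
    by (rule poly_eqI) (simp add: coeff_map_poly)
  then show ?thesis by simp
qed

lemma cpoly_mult: "cpoly (p * q) z = cpoly p z * cpoly q z"
proof -
  have "map_poly complex_of_real (p * q) = map_poly complex_of_real p * map_poly complex_of_real q"
    by (rule poly_eqI) (simp add: coeff_map_poly coeff_mult)
  then show ?thesis by simp
qed

lemma cpoly_sum: "cpoly (\<Sum>i\<in>A. f i) z = (\<Sum>i\<in>A. cpoly (f i) z)"
  by (induction A rule: infinite_finite_induct) (simp_all add: cpoly_add)

lemma cpoly_cnj: "cpoly p (cnj z) = cnj (cpoly p z)"
  by (simp add: poly_altdef coeff_map_poly)

lemma cpoly_linear_power: "cpoly ([:1, -1:] ^ n) z = (1 - z) ^ n"
proof (induction n)
  case (Suc n)
  have "cpoly [:1, -1:] z = 1 - z" by (simp add: map_poly_pCons)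
  then show ?case using Suc by (simp only: power_Suc cpoly_mult)
qed simp

text \<open>Nonvanishing relies on turning: the \<open>r\<close> terms of a window lie in one cone,
  so \<open>turning_sum_nonzero\<close> applies to their sum.\<close>

lemma window_poly_turning:
  assumes z: "0 < Im z" and r: "0 < r"
  shows "turning r z (\<lambda>i. cpoly (window_poly r n i) z)"
    and "cpoly (window_poly r n i) z \<noteq> 0"
proof (induction n arbitrary: i)
  case 0
  have eval: "cpoly (window_poly r 0 i) z = z ^ (i div r)" for i
    by (simp add: map_poly_monom poly_monom)
  { case 1
    have "0 \<le> cross (z ^ (i div r)) (z ^ (j div r))" if "i \<le> j" "j \<le> i + r" for i j
    proof -
      \<comment> \<open>Within one period the exponent grows by 0 or 1, so the cross product is 0 or
        \<open>Im z\<close> times a square.\<close>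
      have "i div r \<le> j div r" "j div r \<le> (i + r) div r"
        using that by (intro div_le_mono; simp)+
      then have "j div r = i div r \<or> j div r = Suc (i div r)"
        using r by auto
      then show ?thesis using z by (auto simp: cross_mult_self)
    qed
    then show ?case unfolding eval turning_def using r by simp
  next
    case 2
    show ?case unfolding eval using z by auto }
next
  case (Suc n)
  have eval: "cpoly (window_poly r (Suc n) i) z = (\<Sum>j<r. cpoly (window_poly r n (i + j)) z)" for i
    by (simp add: cpoly_sum)
  { case 1
    show ?case unfolding eval using turning_window[OF Suc(1)] z by simp
  next
    case 2
    show ?case unfolding eval
      using r by (intro turning_sum_nonzero[OF Suc z, where b = i]) auto }
qed

section \<open>Veronese sections of power series\<close>

abbreviation geom :: "real fps" where
  "geom \<equiv> Abs_fps (\<lambda>_. 1)"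

lemma geom_inverse: "(1 - fps_X) * geom = 1"
  by (rule fps_ext) (simp add: left_diff_distrib)

text \<open>For positive \<open>r\<close> the offset \<open>r - 1\<close> makes the section of
  \<open>fps_X ^ i * geom\<close> start at degree \<open>i div r\<close>: the exponent
  \<open>r * m + (r - 1)\<close> reaches \<open>i\<close> exactly when \<open>m\<close> reaches
  \<open>i div r\<close>.\<close>

definition fps_section :: "nat \<Rightarrow> real fps \<Rightarrow> real fps" where
  "fps_section r A = Abs_fps (\<lambda>m. fps_nth A (r * m + (r - 1)))"

lemma fps_section_sum: "fps_section r (\<Sum>i\<in>I. f i) = (\<Sum>i\<in>I. fps_section r (f i))"
  by (rule fps_ext) (simp add: fps_section_def fps_sum_nth)

lemma fps_section_X_power_mult:
  assumes "0 < r"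
  shows "fps_section r ((1 - fps_X ^ r) * A) = (1 - fps_X) * fps_section r A"
proof (rule fps_ext)
  fix m
  show "fps_nth (fps_section r ((1 - fps_X ^ r) * A)) m = fps_nth ((1 - fps_X) * fps_section r A) m"
    using assms
    by (cases m) (simp_all add: fps_section_def left_diff_distrib fps_X_power_mult_nth)
qed

lemma geom_truncate: "(1 - fps_X ^ r) * geom = (\<Sum>j<r. fps_X ^ j)"
proof -
  have "1 - fps_X ^ r = (1 - fps_X) * (\<Sum>j<r. (fps_X :: real fps) ^ j)"
    by (rule one_diff_power_eq)
  then have "(1 - fps_X ^ r) * geom = ((1 - fps_X) * geom) * (\<Sum>j<r. fps_X ^ j)"
    by (simp only: mult_ac)
  then show ?thesis unfolding geom_inverse by simp
qed

text \<open>A window sum multiplies the series inside the section by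
  \<open>1 + X + ... + X ^ (r - 1)\<close>, which is \<open>(1 - X ^ r) * geom\<close>. The factor
  \<open>1 - X ^ r\<close> leaves the section as \<open>1 - X\<close>.\<close>

lemma fps_of_window_poly:
  assumes r: "0 < r"
  shows "fps_of_poly (window_poly r n i) =
         (1 - fps_X) ^ Suc n * fps_section r (fps_X ^ i * geom ^ Suc n)"
proof (induction n arbitrary: i)
  case 0
  have "fps_section r (fps_X ^ i * geom) = fps_X ^ (i div r) * geom"
  proof (rule fps_ext)
    fix m
    have "r * m + (r - 1) < i \<longleftrightarrow> r * Suc m \<le> i" using r by auto
    also have "\<dots> \<longleftrightarrow> m < i div r"
      by (metis Suc_le_eq less_eq_div_iff_mult_less_eq mult.commute r)
    finally show "fps_nth (fps_section r (fps_X ^ i * geom)) m = fps_nth (fps_X ^ (i div r) * geom) m"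
      by (simp add: fps_section_def fps_X_power_mult_nth)
  qed
  then have "(1 - fps_X) * fps_section r (fps_X ^ i * geom) = ((1 - fps_X) * geom) * fps_X ^ (i div r)"
    by (simp only: mult_ac)
  then show ?case by (simp add: geom_inverse fps_of_poly_monom)
next
  case (Suc n)
  have "fps_of_poly (window_poly r (Suc n) i) =
      (\<Sum>j<r. (1 - fps_X) ^ Suc n * fps_section r (fps_X ^ (i + j) * geom ^ Suc n))"
    by (simp only: window_poly.simps fps_of_poly_sum Suc.IH)
  also have "\<dots> = (1 - fps_X) ^ Suc n *
      fps_section r (((1 - fps_X ^ r) * geom) * (fps_X ^ i * geom ^ Suc n))"
  proof -
    have "((1 - fps_X ^ r) * geom) * (fps_X ^ i * g) = (\<Sum>j<r. fps_X ^ (i + j) * g)" for g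
      unfolding geom_truncate by (simp add: sum_distrib_left sum_distrib_right power_add mult_ac)
    then show ?thesis by (simp only: fps_section_sum sum_distrib_left)
  qed
  also have "((1 - fps_X ^ r) * geom) * (fps_X ^ i * geom ^ Suc n) =
      (1 - fps_X ^ r) * (fps_X ^ i * geom ^ Suc (Suc n))"
    by (simp only: power_Suc mult_ac)
  finally show ?case
    unfolding fps_section_X_power_mult[OF r] power_Suc[of _ "Suc n"] by (simp only: mult_ac)
qed

section \<open>Hilbert series of simplicial complexes\<close>

definition nsupp :: "('a \<Rightarrow> nat) \<Rightarrow> 'a set" where
  "nsupp y = {i. y i \<noteq> 0}"

definition monomials :: "'a set set \<Rightarrow> nat \<Rightarrow> ('a \<Rightarrow> nat) set" where
  "monomials K n = {y. nsupp y \<in> K \<and> sum y (nsupp y) = n}"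

text \<open>The degree is summed over all of \<open>F\<close>, not over the support, so that one
  element of \<open>F\<close> can be split off at a time.\<close>

definition interval_monomials :: "'a set \<Rightarrow> 'a set \<Rightarrow> nat \<Rightarrow> ('a \<Rightarrow> nat) set" where
  "interval_monomials R F n = {y. R \<subseteq> nsupp y \<and> nsupp y \<subseteq> F \<and> sum y F = n}"

lemma sum_nsupp:
  assumes "finite F" "nsupp y \<subseteq> F"
  shows "sum y (nsupp y) = sum y F"
  using assms by (intro sum.mono_neutral_left) (auto simp: nsupp_def)

lemma interval_monomials_insert:
  assumes F: "finite F" "a \<notin> F"
  shows "bij_betw (\<lambda>y. (y a, y(a := 0))) (interval_monomials R (insert a F) n)
    (SIGMA k:{k \<in> {0..n}. a \<in> R \<longrightarrow> 0 < k}. interval_monomials (R - {a}) F (n - k))"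
proof (rule bij_betw_byWitness[where f' = "\<lambda>(k, y). y(a := k)"])
  have upd: "sum (y(a := k)) F = sum y F" for y :: "'a \<Rightarrow> nat" and k
    using F by (intro sum.cong) auto
  show "\<forall>y\<in>interval_monomials R (insert a F) n.
      (\<lambda>(k, y). y(a := k)) (y a, y(a := 0)) = y"
    by simp
  show "\<forall>p\<in>SIGMA k:{k \<in> {0..n}. a \<in> R \<longrightarrow> 0 < k}. interval_monomials (R - {a}) F (n - k).
      (\<lambda>y. (y a, y(a := 0))) ((\<lambda>(k, y). y(a := k)) p) = p"
    using F by (auto simp: interval_monomials_def nsupp_def fun_eq_iff)
  show "(\<lambda>y. (y a, y(a := 0))) ` interval_monomials R (insert a F) n
      \<subseteq> (SIGMA k:{k \<in> {0..n}. a \<in> R \<longrightarrow> 0 < k}. interval_monomials (R - {a}) F (n - k))"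
  proof (rule image_subsetI)
    fix y assume "y \<in> interval_monomials R (insert a F) n"
    then have y: "\<And>i. i \<in> R \<Longrightarrow> y i \<noteq> 0" "\<And>i. y i \<noteq> 0 \<Longrightarrow> i = a \<or> i \<in> F" "y a + sum y F = n"
      using F by (auto simp: interval_monomials_def nsupp_def)
    then have "y(a := 0) \<in> interval_monomials (R - {a}) F (n - y a)"
      unfolding interval_monomials_def mem_Collect_eq upd by (auto simp: nsupp_def)
    then show "(y a, y(a := 0)) \<in>
        (SIGMA k:{k \<in> {0..n}. a \<in> R \<longrightarrow> 0 < k}. interval_monomials (R - {a}) F (n - k))"
      using y by auto
  qed
  show "(\<lambda>(k, y). y(a := k)) ` (SIGMA k:{k \<in> {0..n}. a \<in> R \<longrightarrow> 0 < k}.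
      interval_monomials (R - {a}) F (n - k)) \<subseteq> interval_monomials R (insert a F) n"
  proof (rule image_subsetI, clarify)
    fix k y
    assume k: "k \<in> {0..n}" "a \<in> R \<longrightarrow> 0 < k" and y: "y \<in> interval_monomials (R - {a}) F (n - k)"
    have ins: "sum (y(a := k)) (insert a F) = k + sum y F"
      by (simp only: sum.insert[OF F] upd fun_upd_same)
    show "y(a := k) \<in> interval_monomials R (insert a F) n"
      using k y unfolding interval_monomials_def mem_Collect_eq ins by (auto simp: nsupp_def)
  qed
qed

text \<open>A vertex of \<open>R\<close> has a positive exponent and contributes
  \<open>fps_X * geom\<close>; any other vertex of \<open>F\<close> contributes
  \<open>geom\<close>.\<close>

lemma card_interval_monomials:
  assumes "finite F" "R \<subseteq> F"
  shows "finite (interval_monomials R F n) \<and>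
    real (card (interval_monomials R F n)) = fps_nth (fps_X ^ card R * geom ^ card F) n"
  using assms
proof (induction F arbitrary: R n rule: finite_induct)
  case empty
  have "interval_monomials R {} n = (if n = 0 then {\<lambda>_. 0} else {})"
    using empty by (auto simp: interval_monomials_def nsupp_def)
  then show ?case using empty by simp
next
  case (insert a F)
  let ?I = "{k \<in> {0..n}. a \<in> R \<longrightarrow> 0 < k}"
  let ?A = "fps_X ^ card (R - {a}) * geom ^ card F"
  define g where "g = (if a \<in> R then fps_X * geom else geom)"
  have IH: "finite (interval_monomials (R - {a}) F k)"
    "real (card (interval_monomials (R - {a}) F k)) = fps_nth ?A k" for k
    using insert.IH[of "R - {a}" k] insert.prems by auto
  have finR: "finite R" using insert finite_subset by blast
  note bij = interval_monomials_insert[OF insert.hyps(1,2), of R n]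
  have "real (card (interval_monomials R (insert a F) n)) =
      (\<Sum>k\<in>?I. fps_nth ?A (n - k))"
    using IH by (simp add: bij_betw_same_card[OF bij] card_SigmaI)
  also have "\<dots> = (\<Sum>k = 0..n. fps_nth g k * fps_nth ?A (n - k))"
    by (rule sum.mono_neutral_cong_left) (auto simp: g_def)
  also have "\<dots> = fps_nth (g * ?A) n"
    by (rule fps_mult_nth[symmetric])
  also have "g * ?A = fps_X ^ card R * geom ^ card (insert a F)"
  proof (cases "a \<in> R")
    case True
    then show ?thesis
      unfolding g_def card_Suc_Diff1[OF finR True, symmetric]
        card_insert_disjoint[OF insert.hyps(1,2)]
      by (simp only: if_True power_Suc mult_ac)
  next
    case False
    then show ?thesis using insert.hyps by (simp add: g_def mult_ac)
  qed
  finally show ?case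
    using bij_betw_finite[OF bij] IH by simp
qed

definition hilbert_fps :: "'a set set \<Rightarrow> real fps" where
  "hilbert_fps K = Abs_fps (\<lambda>n. real (card (monomials K n)))"

text \<open>The support of each monomial lies in exactly one of the intervals. This serves twice:
  for the partition into single faces and for the one given by a shelling.\<close>

lemma hilbert_fps_partition:
  assumes "finite J" and RF: "\<And>j. j \<in> J \<Longrightarrow> finite (F j) \<and> R j \<subseteq> F j"
    and K: "K = (\<Union>j\<in>J. {G. R j \<subseteq> G \<and> G \<subseteq> F j})"
    and disj: "disjoint_family_on (\<lambda>j. {G. R j \<subseteq> G \<and> G \<subseteq> F j}) J"
  shows "hilbert_fps K = (\<Sum>j\<in>J. fps_X ^ card (R j) * geom ^ card (F j))"
proof (rule fps_ext)
  fix n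
  have "sum y (nsupp y) = n \<longleftrightarrow> sum y (F j) = n" if "j \<in> J" "nsupp y \<subseteq> F j" for y j
    using RF[OF that(1)] that(2) by (simp add: sum_nsupp[of "F j" y])
  then have "nsupp y \<in> K \<and> sum y (nsupp y) = n \<longleftrightarrow>
      (\<exists>j\<in>J. R j \<subseteq> nsupp y \<and> nsupp y \<subseteq> F j \<and> sum y (F j) = n)" for y
    unfolding K by blast
  then have "monomials K n = (\<Union>j\<in>J. interval_monomials (R j) (F j) n)"
    unfolding monomials_def interval_monomials_def by blast
  moreover have "interval_monomials (R i) (F i) n \<inter> interval_monomials (R j) (F j) n = {}"
    if "i \<in> J" "j \<in> J" "i \<noteq> j" for i j
    using disjoint_family_onD[OF disj that] unfolding interval_monomials_def by blast
  moreover have ci: "finite (interval_monomials (R j) (F j) n)"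
    "real (card (interval_monomials (R j) (F j) n)) =
      fps_nth (fps_X ^ card (R j) * geom ^ card (F j)) n" if "j \<in> J" for j
    using card_interval_monomials RF[OF that] by blast+
  ultimately have "card (monomials K n) = (\<Sum>j\<in>J. card (interval_monomials (R j) (F j) n))"
    using assms(1) by (subst card_UN_disjoint[symmetric]) auto
  then show "fps_nth (hilbert_fps K) n =
      fps_nth (\<Sum>j\<in>J. fps_X ^ card (R j) * geom ^ card (F j)) n"
    using ci by (simp add: hilbert_fps_def fps_sum_nth)
qed

section \<open>The h-polynomial as numerator of the Hilbert series\<close>

lemma h_polynomial_altdef:
  assumes "finite K" "K \<noteq> {}"
  shows "h_polynomial K =
    (\<Sum>F\<in>K. [:0, 1:] ^ card F * [:1, -1:] ^ (Max (card ` K) - card F))"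
proof -
  have M: "nat (complex_dim K + 1) = Max (card ` K)"
    by (simp add: complex_dim_def)
  have num: "face_number K (int i - 1) = card {F \<in> K. card F = i}" for i
    by (simp add: face_number_def)
  have "h_polynomial K = (\<Sum>i\<le>Max (card ` K). of_nat (card {F \<in> K. card F = i}) *
      ([:0, 1:] ^ i * [:1, -1:] ^ (Max (card ` K) - i)))"
    unfolding h_polynomial_def M
    by (intro sum.cong refl)
      (simp add: f_polynomial_def M coeff_sum num of_nat_poly)
  also have "\<dots> = (\<Sum>i\<le>Max (card ` K). \<Sum>F\<in>{F \<in> K. card F = i}.
      [:0, 1:] ^ card F * [:1, -1:] ^ (Max (card ` K) - card F))"
    by simp
  also have "\<dots> = (\<Sum>F\<in>K. [:0, 1:] ^ card F * [:1, -1:] ^ (Max (card ` K) - card F))"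
    using assms by (intro sum.group) auto
  finally show ?thesis .
qed

lemma fps_of_h_polynomial:
  assumes "finite K" "K \<noteq> {}" "\<And>F. F \<in> K \<Longrightarrow> finite F"
  shows "fps_of_poly (h_polynomial K) = (1 - fps_X) ^ Max (card ` K) * hilbert_fps K"
proof -
  \<comment> \<open>Each face \<open>F\<close> is taken as the one-element interval from
    \<open>F\<close> to \<open>F\<close>.\<close>
  have hilb: "hilbert_fps K = (\<Sum>F\<in>K. fps_X ^ card F * geom ^ card F)"
    using assms by (intro hilbert_fps_partition) (auto simp: disjoint_family_on_def)
  have step: "(1 - fps_X) ^ Max (card ` K) * (fps_X ^ card F * geom ^ card F) =
      fps_X ^ card F * (1 - fps_X) ^ (Max (card ` K) - card F)" if "F \<in> K" for F
  proof -
    have "(1 - fps_X) ^ Max (card ` K) =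
        (1 - fps_X) ^ (Max (card ` K) - card F) * (1 - fps_X :: real fps) ^ card F"
      using that assms by (simp flip: power_add)
    then have "(1 - fps_X) ^ Max (card ` K) * (fps_X ^ card F * geom ^ card F) =
        fps_X ^ card F * (1 - fps_X) ^ (Max (card ` K) - card F) * ((1 - fps_X) * geom) ^ card F"
      by (simp only: power_mult_distrib mult_ac)
    then show ?thesis by (simp add: geom_inverse)
  qed
  have "fps_of_poly ([:0, 1:] ^ a * [:1, -1:] ^ b) = fps_X ^ a * (1 - fps_X :: real fps) ^ b" for a b
    by (simp add: fps_of_poly_mult fps_of_poly_power fps_of_poly_linear')
  then show ?thesis
    unfolding h_polynomial_altdef[OF assms(1,2)] fps_of_poly_sum hilb sum_distrib_left
    by (intro sum.cong refl) (simp only: step)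
qed

section \<open>Partition of a shellable complex\<close>

lemma shelling_facets:
  assumes "shelling d K Fs"
  shows "set Fs = facets K"
  using assms by (cases d) auto

lemma facets_boundary_complex:
  assumes "G \<in> facets (boundary_complex F)"
  shows "\<exists>v\<in>F. G = F - {v}"
proof -
  have G: "G \<subseteq> F" "G \<noteq> F" "\<And>H. H \<subseteq> F \<Longrightarrow> H \<noteq> F \<Longrightarrow> G \<subseteq> H \<Longrightarrow> H = G"
    using assms by (auto simp: facets_def boundary_complex_def)
  then obtain v where v: "v \<in> F" "v \<notin> G" by blast
  have "F - {v} = G" using G(1) v by (intro G(3)) auto
  then show ?thesis using v by blast
qed

lemma facet_exists:
  assumes "finite K" "F \<in> K"
  shows "\<exists>V\<in>facets K. F \<subseteq> V"
proof -
  obtain V where "V \<in> K" "F \<subseteq> V" "\<forall>G\<in>K. V \<subseteq> G \<longrightarrow> V = G"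
    using finite_has_maximal2[OF assms] by blast
  then show ?thesis unfolding facets_def by blast
qed

text \<open>\<open>R\<close> collects the vertices \<open>v\<close> whose opposite ridge
  \<open>Fs ! j - {v}\<close> is among those glued to earlier facets; a face lies in one of these
  ridges iff it misses a vertex of \<open>R\<close>. For the first facet \<open>R\<close> is
  empty.\<close>

lemma shelling_restriction:
  assumes "\<And>F. F \<in> facets K \<Longrightarrow> card F = Suc d" and Fs: "shelling d K Fs" and j: "j < length Fs"
  shows "\<exists>R. R \<subseteq> Fs ! j \<and>
    (\<forall>G. G \<subseteq> Fs ! j \<longrightarrow> (\<exists>i<j. G \<subseteq> Fs ! i) \<longleftrightarrow> \<not> R \<subseteq> G)"
proof (cases "j = 0")
  case True
  then show ?thesis by auto
next
  case j0: False
  show ?thesis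
  proof (cases d)
    case 0
    \<comment> \<open>A shelling in dimension 0 has no gluing condition. The facets are distinct
      single vertices, so only the empty face is shared and \<open>R\<close> is the whole
      facet.\<close>
    have single: "\<exists>v. Fs ! i = {v}" if "i < length Fs" for i
      using assms(1)[of "Fs ! i"] shelling_facets[OF Fs] that 0 nth_mem
      by (metis One_nat_def card_1_singletonE)
    have neq: "Fs ! i \<noteq> Fs ! j" if "i < j" for i
      using Fs 0 j that by (simp add: nth_eq_iff_index_eq)
    have "(\<exists>i<j. G \<subseteq> Fs ! i) \<longleftrightarrow> \<not> Fs ! j \<subseteq> G" if G: "G \<subseteq> Fs ! j" for G
    proof
      assume "\<exists>i<j. G \<subseteq> Fs ! i"
      then obtain i where i: "i < j" "G \<subseteq> Fs ! i" by blast
      then show "\<not> Fs ! j \<subseteq> G"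
        using single[of i] single[of j] neq[OF i(1)] j by auto
    next
      assume "\<not> Fs ! j \<subseteq> G"
      then have "G = {}" using single[OF j] G by auto
      then show "\<exists>i<j. G \<subseteq> Fs ! i" using j0 by auto
    qed
    then show ?thesis by blast
  next
    case (Suc d')
    then obtain Gs m where Gs: "shelling d' (boundary_complex (Fs ! j)) Gs" "m \<le> length Gs"
      and cap: "Pow (Fs ! j) \<inter> (\<Union>i<j. Pow (Fs ! i)) = (\<Union>k<m. Pow (Gs ! k))"
      using Fs[unfolded Suc shelling.simps] j j0 by (metis One_nat_def Suc_leI neq0_conv)
    define R where "R = {v \<in> Fs ! j. \<exists>k<m. Gs ! k = Fs ! j - {v}}"
    have ridge: "\<exists>v\<in>Fs ! j. Gs ! k = Fs ! j - {v}" if "k < m" for k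
      using facets_boundary_complex[of "Gs ! k"] shelling_facets[OF Gs(1)] Gs(2) that
        nth_mem[of k Gs] by simp
    have "(\<exists>i<j. G \<subseteq> Fs ! i) \<longleftrightarrow> \<not> R \<subseteq> G" if G: "G \<subseteq> Fs ! j" for G
    proof -
      have "(\<exists>i<j. G \<subseteq> Fs ! i) \<longleftrightarrow> (\<exists>k<m. G \<subseteq> Gs ! k)"
      proof -
        have "(\<exists>i<j. G \<subseteq> Fs ! i) \<longleftrightarrow> G \<in> Pow (Fs ! j) \<inter> (\<Union>i<j. Pow (Fs ! i))"
          using G by blast
        then show ?thesis unfolding cap by blast
      qed
      also have "\<dots> \<longleftrightarrow> (\<exists>v\<in>R. G \<subseteq> Fs ! j - {v})"
        unfolding R_def using ridge by fastforce
      also have "\<dots> \<longleftrightarrow> \<not> R \<subseteq> G"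
        using G by blast
      finally show ?thesis .
    qed
    then show ?thesis unfolding R_def by blast
  qed
qed

text \<open>Each face belongs to the interval of the first facet in the shelling that contains it;
  \<open>e j\<close> is the size of the restriction of the facet with index
  \<open>j\<close>.\<close>

lemma hilbert_fps_shellable:
  assumes C: "simplicial_complex C" and dim: "complex_dim C = int d" and sh: "shellable C"
  shows "\<exists>(J :: nat set) e. finite J \<and> J \<noteq> {} \<and> (\<forall>j\<in>J. e j \<le> Suc d) \<and>
    hilbert_fps C = (\<Sum>j\<in>J. fps_X ^ e j * geom ^ Suc d)"
proof -
  obtain Fs where Fs: "shelling d C Fs" and pure: "pure_complex C"
    using sh dim by (auto simp: shellable_def)
  have fin: "finite C" "{} \<in> C" "\<And>F. F \<in> C \<Longrightarrow> finite F"
    and sub: "\<And>F G. F \<in> C \<Longrightarrow> G \<subseteq> F \<Longrightarrow> G \<in> C"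
    using C by (auto simp: simplicial_complex_def)
  have cardF: "card F = Suc d" if "F \<in> facets C" for F
    using pure that dim by (auto simp: pure_complex_def)
  have set: "set Fs = facets C" by (rule shelling_facets[OF Fs])
  have Fj: "Fs ! j \<in> facets C" if "j < length Fs" for j
    using that set nth_mem by blast
  obtain R where R: "\<And>j. j < length Fs \<Longrightarrow> R j \<subseteq> Fs ! j \<and>
      (\<forall>G. G \<subseteq> Fs ! j \<longrightarrow> (\<exists>i<j. G \<subseteq> Fs ! i) \<longleftrightarrow> \<not> R j \<subseteq> G)"
    using shelling_restriction[OF cardF Fs] by metis
  let ?J = "{..<length Fs}"
  have "hilbert_fps C = (\<Sum>j\<in>?J. fps_X ^ card (R j) * geom ^ card (Fs ! j))"
  proof (rule hilbert_fps_partition)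
    show "finite (Fs ! j) \<and> R j \<subseteq> Fs ! j" if "j \<in> ?J" for j
      using that R Fj fin(3) by (auto simp: facets_def)
    show "C = (\<Union>j\<in>?J. {G. R j \<subseteq> G \<and> G \<subseteq> Fs ! j})"
    proof (intro equalityI subsetI)
      fix G assume "G \<in> C"
      then have "\<exists>j. j < length Fs \<and> G \<subseteq> Fs ! j"
        using facet_exists[OF fin(1)] set by (metis in_set_conv_nth)
      then obtain j where j: "j < length Fs" "G \<subseteq> Fs ! j"
        and least: "\<And>i. i < j \<Longrightarrow> \<not> (i < length Fs \<and> G \<subseteq> Fs ! i)"
        using exists_least_iff[of "\<lambda>j. j < length Fs \<and> G \<subseteq> Fs ! j"] by blast
      have "\<not> (\<exists>i<j. G \<subseteq> Fs ! i)" using least j(1) less_trans by blast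
      then have "R j \<subseteq> G" using R[OF j(1)] j(2) by blast
      then show "G \<in> (\<Union>j\<in>?J. {G. R j \<subseteq> G \<and> G \<subseteq> Fs ! j})" using j by blast
    next
      fix G assume "G \<in> (\<Union>j\<in>?J. {G. R j \<subseteq> G \<and> G \<subseteq> Fs ! j})"
      then show "G \<in> C" using Fj sub unfolding facets_def by blast
    qed
    have disj: "{G. R i \<subseteq> G \<and> G \<subseteq> Fs ! i} \<inter> {G. R j \<subseteq> G \<and> G \<subseteq> Fs ! j} = {}"
      if "i < j" "j < length Fs" for i j
    proof -
      have "\<not> G \<subseteq> Fs ! i" if "R j \<subseteq> G" "G \<subseteq> Fs ! j" for G
        using R[OF \<open>j < length Fs\<close>] \<open>i < j\<close> that by blast
      then show ?thesis by blast
    qed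
    then show "disjoint_family_on (\<lambda>j. {G. R j \<subseteq> G \<and> G \<subseteq> Fs ! j}) ?J"
      unfolding disjoint_family_on_def
    proof (intro ballI impI)
      fix i j assume ij: "i \<in> ?J" "j \<in> ?J" "i \<noteq> j"
      then consider "i < j" | "j < i" by linarith
      then show "{G. R i \<subseteq> G \<and> G \<subseteq> Fs ! i} \<inter> {G. R j \<subseteq> G \<and> G \<subseteq> Fs ! j} = {}"
        using disj[of i j] disj[of j i] ij by cases auto
    qed
  qed simp
  also have "\<dots> = (\<Sum>j\<in>?J. fps_X ^ card (R j) * geom ^ Suc d)"
    using Fj cardF by (intro sum.cong) auto
  finally have eq: "hilbert_fps C = (\<Sum>j\<in>?J. fps_X ^ card (R j) * geom ^ Suc d)" .
  have le: "card (R j) \<le> Suc d" if "j \<in> ?J" for j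
  proof -
    have j: "j < length Fs" using that by simp
    have "card (R j) \<le> card (Fs ! j)"
      using Fj[OF j] fin(3) R[OF j] by (intro card_mono) (auto simp: facets_def)
    then show ?thesis using cardF[OF Fj[OF j]] by simp
  qed
  have ne: "?J \<noteq> {}"
    using facet_exists[OF fin(1,2)] set by (cases Fs) auto
  show ?thesis
    by (rule exI[of _ ?J], rule exI[of _ "\<lambda>j. card (R j)"]) (intro conjI ballI finite_lessThan ne le eq)
qed

section \<open>Unique decomposition in the edgewise subdivision\<close>

text \<open>The partial sum strictly below \<open>k\<close> is the one up to the predecessor of
  \<open>k\<close> in \<open>A\<close>. Later \<open>G\<close> is a shifted floor and
  \<open>A\<close> a support or an initial segment of it.\<close>

lemma sum_telescope_linorder:
  fixes y :: "'v::linorder \<Rightarrow> int" and G :: "int \<Rightarrow> int"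
  assumes "finite A"
  shows "(\<Sum>k\<in>A. G (\<Sum>l\<in>{l\<in>A. l \<le> k}. y l) - G (\<Sum>l\<in>{l\<in>A. l < k}. y l)) = G (sum y A) - G 0"
  using assms
proof (induction A rule: finite_linorder_max_induct)
  case (insert b A)
  have sets: "{l \<in> insert b A. l \<le> k} = {l\<in>A. l \<le> k}" "{l \<in> insert b A. l < k} = {l\<in>A. l < k}"
    if "k \<in> A" for k
    using insert.hyps(2) that by force+
  have top: "{l \<in> insert b A. l \<le> b} = insert b A" "{l \<in> insert b A. l < b} = A"
    using insert.hyps(2) by force+
  have b: "b \<notin> A" using insert.hyps(2) by blast
  have "(\<Sum>k\<in>A. G (\<Sum>l\<in>{l \<in> insert b A. l \<le> k}. y l) - G (\<Sum>l\<in>{l \<in> insert b A. l < k}. y l)) =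
      G (sum y A) - G 0"
    unfolding insert.IH[symmetric] by (intro sum.cong refl) (simp only: sets)
  then show ?case
    unfolding sum.insert[OF insert.hyps(1) b] top by simp
qed simp

text \<open>If \<open>b = n * q + s\<close> with \<open>0 \<le> s < n\<close>, exactly the last
  \<open>s\<close> of the \<open>n\<close> shifts reach the next multiple of
  \<open>n\<close>.\<close>

lemma sum_floor_shift:
  fixes b :: int
  assumes "0 < n"
  shows "(\<Sum>j<n. (b + int j) div int n) = b"
proof -
  define q s where "q = b div int n" and "s = nat (b mod int n)"
  have b: "b = int n * q + int s" and s: "s < n"
    using assms by (simp_all add: q_def s_def nat_less_iff)
  have "(b + int j) div int n = q + (if n - s \<le> j then 1 else 0)" if "j < n" for j
  proof (cases "n - s \<le> j")
    case True
    then have "(b + int j) div int n = q + 1"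
      using s that b by (intro int_div_pos_eq[where r = "int s + int j - int n"]) (auto simp: algebra_simps)
    then show ?thesis using True by simp
  next
    case False
    then have "(b + int j) div int n = q"
      using s that b by (intro int_div_pos_eq[where r = "int s + int j"]) auto
    then show ?thesis using False by simp
  qed
  then have "(\<Sum>j<n. (b + int j) div int n) = (\<Sum>j<n. q + (if n - s \<le> j then 1 else 0))"
    by simp
  also have "\<dots> = int n * q + (\<Sum>j<n. if n - s \<le> j then 1 else 0)"
    by (simp add: sum.distrib)
  also have "(\<Sum>j<n. if n - s \<le> j then 1 else 0) = (\<Sum>j\<in>{n - s..<n}. (1::int))"
    by (intro sum.mono_neutral_cong_right) auto
  also have "int n * q + \<dots> = b" using s b by simp
  finally show ?thesis .
qed

text \<open>The partial sums of the slices are \<open>\<lfloor>(b + j) / n\<rfloor>\<close>, where \<open>b\<close> runs through the partial sums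
  of \<open>y\<close>.  For fixed \<open>b\<close> these values differ by at most one and add up to \<open>b\<close>, by Hermite's
  identity.\<close>

definition slice :: "nat \<Rightarrow> ('v::linorder \<Rightarrow> nat) \<Rightarrow> nat \<Rightarrow> 'v \<Rightarrow> int" where
  "slice n y j i = ((\<Sum>k\<in>{k \<in> nsupp y. k \<le> i}. int (y k)) + int j) div int n -
     ((\<Sum>k\<in>{k \<in> nsupp y. k < i}. int (y k)) + int j) div int n"

text \<open>The \<open>n\<close> slices of \<open>y\<close>, with repetitions, as a monomial of
  degree \<open>n\<close> in lattice points; on the monomials concerned \<open>total\<close> is the
  inverse.\<close>

definition slice_count :: "nat \<Rightarrow> ('v::linorder \<Rightarrow> nat) \<Rightarrow> ('v \<Rightarrow> int) \<Rightarrow> nat" where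
  "slice_count n y x = card {j. j < n \<and> slice n y j = x}"

definition total :: "(('v \<Rightarrow> int) \<Rightarrow> nat) \<Rightarrow> 'v \<Rightarrow> nat" where
  "total g i = nat (\<Sum>x\<in>nsupp g. int (g x) * x i)"

lemma sum_slice:
  assumes "finite (nsupp y)" "j < n"
  shows "sum (slice n y j) (nsupp y) = ((\<Sum>i\<in>nsupp y. int (y i)) + int j) div int n"
  using sum_telescope_linorder[OF assms(1), of "\<lambda>b. (b + int j) div int n" "\<lambda>i. int (y i)"] assms(2)
  by (simp add: slice_def)

text \<open>The slices telescope over the support up to \<open>i\<close>. As \<open>j < n\<close>,
  the initial value \<open>j div n\<close> is zero.\<close>

lemma iota_slice:
  assumes fin: "finite (nsupp y)" and "j < n"
  shows "iota (nsupp y) (slice n y j) i = (iota (nsupp y) (\<lambda>i. int (y i)) i + int j) div int n"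
proof -
  let ?A = "{k \<in> nsupp y. k \<le> i}"
  have sets: "{l \<in> ?A. l \<le> k} = {l \<in> nsupp y. l \<le> k}" "{l \<in> ?A. l < k} = {l \<in> nsupp y. l < k}"
    if "k \<in> ?A" for k
    using that by auto
  have "iota (nsupp y) (slice n y j) i =
      (\<Sum>k\<in>?A. ((\<Sum>l\<in>{l \<in> ?A. l \<le> k}. int (y l)) + int j) div int n -
        ((\<Sum>l\<in>{l \<in> ?A. l < k}. int (y l)) + int j) div int n)"
    unfolding iota_def slice_def by (intro sum.cong refl) (simp only: sets)
  then show ?thesis
    using sum_telescope_linorder[of ?A "\<lambda>b. (b + int j) div int n" "\<lambda>i. int (y i)"] assms
    by (simp add: iota_def)
qed

lemma slice_outside:
  assumes "i \<notin> nsupp y"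
  shows "slice n y j i = 0"
proof -
  have "{k \<in> nsupp y. k \<le> i} = {k \<in> nsupp y. k < i}" using assms by (auto simp: less_le)
  then show ?thesis by (simp add: slice_def)
qed

lemma slice_nonneg:
  assumes "finite (nsupp y)"
  shows "0 \<le> slice n y j i"
  unfolding slice_def using assms
  by (cases "n = 0") (auto intro!: zdiv_mono1 sum_mono2)

lemma sum_slice_pointwise:
  assumes "finite (nsupp y)" "0 < n"
  shows "(\<Sum>j<n. slice n y j i) = int (y i)"
proof -
  have "(\<Sum>j<n. slice n y j i) = (\<Sum>k\<in>{k \<in> nsupp y. k \<le> i}. int (y k)) - (\<Sum>k\<in>{k \<in> nsupp y. k < i}. int (y k))"
    unfolding slice_def by (simp add: sum_subtractf sum_floor_shift[OF assms(2)])
  also have "\<dots> = (\<Sum>k\<in>{k \<in> nsupp y. k \<le> i} - {k \<in> nsupp y. k < i}. int (y k))"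
    using assms(1) by (intro sum_diff[symmetric]) auto
  also have "\<dots> = (\<Sum>k\<in>{i}. int (y k))"
    by (rule sum.mono_neutral_left) (auto simp: nsupp_def)
  finally show ?thesis by simp
qed

lemma nsupp_slice_count: "nsupp (slice_count n y) = slice n y ` {..<n}"
  by (auto simp: nsupp_def slice_count_def card_eq_0_iff)

text \<open>Groups the indices by their slice. Constant \<open>f = 1\<close> yields the degree, a
  coordinate as \<open>f\<close> yields \<open>total\<close>.\<close>

lemma sum_slice_count:
  fixes f :: "('v::linorder \<Rightarrow> int) \<Rightarrow> int"
  shows "(\<Sum>x\<in>nsupp (slice_count n y). int (slice_count n y x) * f x) = (\<Sum>j<n. f (slice n y j))"
proof -
  have fibre: "int (slice_count n y x) * f x = (\<Sum>j\<in>{j \<in> {..<n}. slice n y j = x}. f (slice n y j))" for x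
    by (simp add: slice_count_def lessThan_def)
  have "(\<Sum>x\<in>nsupp (slice_count n y). int (slice_count n y x) * f x) =
      (\<Sum>x\<in>slice n y ` {..<n}. \<Sum>j\<in>{j \<in> {..<n}. slice n y j = x}. f (slice n y j))"
    by (simp only: nsupp_slice_count fibre)
  also have "\<dots> = (\<Sum>j<n. f (slice n y j))"
    by (intro sum.group) auto
  finally show ?thesis .
qed

text \<open>The full sum gives \<open>(r * n + j) div n = r\<close>, so slices are lattice points of
  the dilation. Raising \<open>j\<close> to another index below \<open>n\<close> raises each floor
  by at most one, so they form a chain.\<close>

lemma slices_edgewise:
  assumes fin: "finite (nsupp y)" and n: "0 < n" and sum: "sum y (nsupp y) = r * n"
  shows "slice n y ` {..<n} \<in> edgewise_simplex (nsupp y) r"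
proof -
  have points: "slice n y j \<in> lattice_points (nsupp y) r" if j: "j < n" for j
  proof -
    have "(\<Sum>i\<in>nsupp y. int (y i)) = int r * int n"
      using sum by (metis of_nat_mult of_nat_sum)
    then have "sum (slice n y j) (nsupp y) = int r"
      using j by (simp add: sum_slice[OF fin j])
    then show ?thesis
      by (simp add: lattice_points_def slice_nonneg[OF fin] slice_outside)
  qed
  have supports: "(\<Union>x\<in>slice n y ` {..<n}. supp x) \<subseteq> nsupp y"
    by (auto simp: supp_def slice_outside intro: ccontr)
  have chain: "iota (nsupp y) (slice n y k) i - iota (nsupp y) (slice n y j) i \<in> {0, 1}"
    if "j \<le> k" "k < n" for i j k
  proof -
    define b where "b = iota (nsupp y) (\<lambda>i. int (y i)) i"
    have "(b + int j) div int n \<le> (b + int k) div int n"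
      using that by (intro zdiv_mono1) auto
    moreover have "(b + int k) div int n \<le> (b + int j + int n) div int n"
      using that by (intro zdiv_mono1) auto
    moreover have "(b + int j + int n) div int n = (b + int j) div int n + 1"
      using n by simp
    ultimately show ?thesis
      using that by (auto simp: iota_slice[OF fin] b_def[symmetric])
  qed
  show ?thesis
    unfolding edgewise_simplex_def
  proof (intro CollectI conjI ballI)
    show "slice n y ` {..<n} \<subseteq> lattice_points (nsupp y) r" using points by auto
    show "(\<Union>x\<in>slice n y ` {..<n}. supp x) \<in> Pow (nsupp y)" using supports by simp
    fix x x' assume "x \<in> slice n y ` {..<n}" "x' \<in> slice n y ` {..<n}"
    then obtain j k where jk: "j < n" "k < n" "x = slice n y j" "x' = slice n y k" by auto
    show "(\<forall>i\<in>nsupp y. iota (nsupp y) x i - iota (nsupp y) x' i \<in> {0, 1}) \<or>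
        (\<forall>i\<in>nsupp y. iota (nsupp y) x' i - iota (nsupp y) x i \<in> {0, 1})"
      using chain[of j k] chain[of k j] jk by (cases "j \<le> k") auto
  qed
qed

lemma edgewise_subdivision_face:
  assumes C: "simplicial_complex C" and "U \<in> C" "F \<in> edgewise_simplex U r"
  shows "F \<in> edgewise_subdivision C r"
proof -
  have fin: "finite C" "\<And>F. F \<in> C \<Longrightarrow> finite F"
    using C by (auto simp: simplicial_complex_def)
  obtain V where V: "V \<in> facets C" "U \<subseteq> V"
    using facet_exists[OF fin(1) assms(2)] by blast
  then have "finite V" using fin(2) by (simp add: facets_def)
  then have "F \<in> edgewise_simplex V r"
    using edgewise_simplex_face[of V U r] V(2) assms(3) by blast
  then show ?thesis using V(1) unfolding edgewise_subdivision_def by blast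
qed

lemma slice_count_monomial:
  assumes C: "simplicial_complex C" and n: "0 < n" and y: "y \<in> monomials C (r * n)"
  shows "slice_count n y \<in> monomials (edgewise_subdivision C r) n"
    and "total (slice_count n y) = y"
proof -
  have U: "nsupp y \<in> C" "finite (nsupp y)" "sum y (nsupp y) = r * n"
    using y C by (auto simp: monomials_def simplicial_complex_def)
  have "nsupp (slice_count n y) \<in> edgewise_subdivision C r"
    unfolding nsupp_slice_count
    using edgewise_subdivision_face[OF C U(1)] slices_edgewise[OF U(2) n U(3)] .
  moreover have "sum (slice_count n y) (nsupp (slice_count n y)) = n"
    using sum_slice_count[where f = "\<lambda>_. 1", of n y] by (simp flip: of_nat_sum)
  ultimately show "slice_count n y \<in> monomials (edgewise_subdivision C r) n"
    unfolding monomials_def by simp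
  show "total (slice_count n y) = y"
    unfolding total_def fun_eq_iff
    by (simp add: sum_slice_count[where f = "\<lambda>x. x _"] sum_slice_pointwise[OF U(2) n])
qed

text \<open>At the least index where \<open>x\<close> and \<open>x'\<close> differ, their partial
  sums differ too.\<close>

lemma iota_inject:
  fixes U :: "'v::linorder set"
  assumes fin: "finite U" and out: "\<And>i. i \<notin> U \<Longrightarrow> x i = 0" "\<And>i. i \<notin> U \<Longrightarrow> x' i = 0"
    and eq: "\<And>i. i \<in> U \<Longrightarrow> iota U x i = iota U x' i"
  shows "x = x'"
proof (rule ccontr)
  let ?D = "{i \<in> U. x i \<noteq> x' i}"
  assume "x \<noteq> x'"
  then have D: "finite ?D" "?D \<noteq> {}" using fin out by force+
  define m where "m = Min ?D"
  have m: "m \<in> ?D" unfolding m_def using D by (rule Min_in)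
  have below: "x k = x' k" if "k \<in> U" "k < m" for k
    using Min_le[OF D(1), of k] that unfolding m_def by force
  have split: "{j \<in> U. j \<le> m} = insert m {j \<in> U. j < m}"
    using m by auto
  have "iota U z m = z m + (\<Sum>j\<in>{j \<in> U. j < m}. z j)" for z :: "'v \<Rightarrow> int"
    unfolding iota_def split using fin by simp
  moreover have "(\<Sum>j\<in>{j \<in> U. j < m}. x j) = (\<Sum>j\<in>{j \<in> U. j < m}. x' j)"
    using below by (intro sum.cong) auto
  ultimately show False using eq[of m] m by simp
qed

text \<open>Order \<open>F\<close> as a chain.  If the points below \<open>x\<close> have total weight \<open>l\<close>, then the slices
  with index in \<open>{l..<l + g x}\<close> are all equal to \<open>x\<close>.\<close>

lemma edgewise_weight_le:
  fixes U :: "'v::linorder set"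
  assumes U: "finite U" and F: "F \<in> edgewise_simplex U r" "finite F" and n: "sum g F = n"
    and y: "nsupp y = U" "\<And>i. int (y i) = (\<Sum>x\<in>F. int (g x) * x i)" and x: "x \<in> F"
  shows "g x \<le> slice_count n y x"
proof -
  \<comment> \<open>The points of \<open>F\<close> before and after \<open>x\<close> in the chain;
    \<open>l\<close> is the total weight before \<open>x\<close>.\<close>
  define low where "low = {x' \<in> F. x' \<noteq> x \<and> (\<forall>i\<in>U. iota U x i - iota U x' i \<in> {0, 1})}"
  define high where "high = F - {x} - low"
  define l where "l = sum g low"
  have "sum g F = g x + sum g (F - {x})"
    using F(2) x by (rule sum.remove)
  also have "sum g (F - {x}) = sum g high + l"
    unfolding high_def l_def using F(2) by (intro sum.subset_diff) (auto simp: low_def)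
  finally have n': "n = g x + sum g high + l" using n by simp
  have low_F: "low \<subseteq> F" and high_F: "high \<subseteq> F" by (auto simp: low_def high_def)
  have "slice n y j = x" if j: "l \<le> j" "j < l + g x" for j
  proof (rule iota_inject[OF U])
    show "slice n y j i = 0" if "i \<notin> U" for i
      using that y(1) by (simp add: slice_outside)
    show "x i = 0" if "i \<notin> U" for i
      using that F(1) x by (auto simp: edgewise_simplex_def lattice_points_def)
    fix i assume i: "i \<in> U"
    define q b where "q = iota U x i" and "b = iota U (\<lambda>i. int (y i)) i"
    have b: "b = (\<Sum>x'\<in>F. int (g x') * iota U x' i)"
      unfolding b_def iota_def y(2) sum_distrib_left by (rule sum.swap)
    have val: "q - (if x' \<in> low then 1 else 0) \<le> iota U x' i"
      "iota U x' i \<le> q + (if x' \<in> high then 1 else 0)" if x': "x' \<in> F" for x'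
    proof -
      have cmp: "(\<forall>i\<in>U. iota U x i - iota U x' i \<in> {0, 1}) \<or> (\<forall>i\<in>U. iota U x' i - iota U x i \<in> {0, 1})"
        using F(1) x x' unfolding edgewise_simplex_def by blast
      consider "x' = x" | "x' \<in> low" | "x' \<in> high" "x' \<notin> low" using x' unfolding high_def by blast
      then have "q - (if x' \<in> low then 1 else 0) \<le> iota U x' i \<and>
          iota U x' i \<le> q + (if x' \<in> high then 1 else 0)"
      proof cases
        case 1
        then show ?thesis by (simp add: q_def)
      next
        case 2
        then have "q - iota U x' i \<in> {0, 1}" using i unfolding low_def q_def by blast
        then show ?thesis using 2 by auto
      next
        case 3
        then have "iota U x' i - q \<in> {0, 1}"
          using cmp i x' unfolding high_def low_def q_def by blast
        then show ?thesis using 3 by auto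
      qed
      then show "q - (if x' \<in> low then 1 else 0) \<le> iota U x' i"
        "iota U x' i \<le> q + (if x' \<in> high then 1 else 0)" by blast+
    qed
    have ind: "(\<Sum>x'\<in>F. int (g x') * (if x' \<in> S then 1 else 0)) = int (sum g S)" if "S \<subseteq> F" for S
    proof -
      have "(\<Sum>x'\<in>F. int (g x') * (if x' \<in> S then 1 else 0)) = (\<Sum>x'\<in>S. int (g x'))"
        using F(2) that by (intro sum.mono_neutral_cong_right) auto
      then show ?thesis by simp
    qed
    have wq: "(\<Sum>x'\<in>F. int (g x') * q) = int n * q"
      using n by (simp add: sum_distrib_right[symmetric] of_nat_sum[symmetric] del: of_nat_sum)
    have "(\<Sum>x'\<in>F. int (g x') * (q - (if x' \<in> low then 1 else 0))) \<le> b"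
      unfolding b by (intro sum_mono mult_left_mono val) auto
    then have lower: "int n * q - int l \<le> b"
      using ind[OF low_F] by (simp add: right_diff_distrib sum_subtractf wq l_def)
    have "b \<le> (\<Sum>x'\<in>F. int (g x') * (q + (if x' \<in> high then 1 else 0)))"
      unfolding b by (intro sum_mono mult_left_mono val) auto
    then have upper: "b \<le> int n * q + int (sum g high)"
      using ind[OF high_F] by (simp add: distrib_left sum.distrib wq)
    have jn: "j < n" using j n' by simp
    \<comment> \<open>The remainder \<open>b + j - n * q\<close> lies in \<open>{0..<n}\<close>:
      from below by \<open>l \<le> j\<close>, from above by \<open>j < l + g x\<close> and
      \<open>n = g x + sum g high + l\<close>.\<close>
    have "(b + int j) div int n = q"
      using lower upper j n' by (intro int_div_pos_eq[where r = "b + int j - int n * q"]) auto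
    then show "iota U (slice n y j) i = iota U x i"
      using iota_slice[of y j n i] jn y(1) U unfolding b_def q_def by simp
  qed
  then have "{l..<l + g x} \<subseteq> {j. j < n \<and> slice n y j = x}"
    using n' by auto
  then have "card {l..<l + g x} \<le> slice_count n y x"
    unfolding slice_count_def by (intro card_mono) auto
  then show ?thesis by simp
qed

lemma finite_lattice_points:
  assumes "finite V"
  shows "finite (lattice_points V r)"
proof (rule finite_subset)
  show "lattice_points V r \<subseteq> {x. \<forall>i. (i \<in> V \<longrightarrow> x i \<in> {0..int r}) \<and> (i \<notin> V \<longrightarrow> x i = 0)}"
  proof clarify
    fix x i assume x: "x \<in> lattice_points V r"
    then have "x i \<le> sum x V" if "i \<in> V"
      using assms that by (intro member_le_sum) (auto simp: lattice_points_def)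
    then show "(i \<in> V \<longrightarrow> x i \<in> {0..int r}) \<and> (i \<notin> V \<longrightarrow> x i = 0)"
      using x by (auto simp: lattice_points_def)
  qed
  show "finite {x. \<forall>i. (i \<in> V \<longrightarrow> x i \<in> {0..int r}) \<and> (i \<notin> V \<longrightarrow> x i = 0)}"
    using assms by (intro finite_set_of_finite_funs) auto
qed

lemma finite_edgewise_subdivision:
  assumes C: "simplicial_complex C"
  shows "finite (edgewise_subdivision C r)" "\<And>F. F \<in> edgewise_subdivision C r \<Longrightarrow> finite F"
proof -
  have fin: "finite (facets C)" "\<And>V. V \<in> facets C \<Longrightarrow> finite V"
    using C by (auto simp: simplicial_complex_def facets_def)
  have sub: "edgewise_simplex V r \<subseteq> Pow (lattice_points V r)" for V :: "'a set"
    by (auto simp: edgewise_simplex_def)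
  show "finite (edgewise_subdivision C r)"
    unfolding edgewise_subdivision_def
    using fin finite_lattice_points finite_subset[OF sub] by blast
  show "finite F" if "F \<in> edgewise_subdivision C r" for F
  proof -
    obtain V where "V \<in> facets C" "F \<in> edgewise_simplex V r"
      using \<open>F \<in> edgewise_subdivision C r\<close> unfolding edgewise_subdivision_def by blast
    then show ?thesis
      using sub[of V] finite_lattice_points[OF fin(2)] finite_subset by blast
  qed
qed

text \<open>Each weight \<open>g x\<close> is at most the multiplicity of \<open>x\<close> among the
  slices of the total. Both families of weights add up to \<open>n\<close>, so they agree.\<close>

lemma total_monomial:
  assumes C: "simplicial_complex C" and n: "0 < n"
    and g: "g \<in> monomials (edgewise_subdivision C r) n"
  shows "total g \<in> monomials C (r * n)" and "slice_count n (total g) = g"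
proof -
  let ?F = "nsupp g"
  define y U where "y = total g" and "U = (\<Union>x\<in>?F. supp x)"
  have F: "?F \<in> edgewise_subdivision C r" "sum g ?F = n"
    using g by (auto simp: monomials_def)
  have finF: "finite ?F" by (rule finite_edgewise_subdivision(2)[OF C F(1)])
  obtain V where V: "V \<in> facets C" "?F \<in> edgewise_simplex V r"
    using F(1) unfolding edgewise_subdivision_def by blast
  have VC: "V \<in> C" "finite V" using V(1) C by (auto simp: facets_def simplicial_complex_def)
  have UV: "U \<subseteq> V" using V(2) unfolding edgewise_simplex_def U_def by blast
  then have U: "U \<in> C" "finite U"
    using VC C finite_subset by (auto simp: simplicial_complex_def)
  \<comment> \<open>The chain condition moves from the facet \<open>V\<close> to its face
    \<open>U\<close>, because slices are formed along the support of \<open>y\<close>, which is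
    \<open>U\<close>.\<close>
  have FU: "?F \<in> edgewise_simplex U r"
    using edgewise_simplex_face[OF VC(2) UV, of r] V(2) unfolding U_def by blast
  then have pts: "x \<in> lattice_points U r" if "x \<in> ?F" for x
    using that by (auto simp: edgewise_simplex_def)
  then have nonneg: "0 \<le> x i" if "x \<in> ?F" for x i
    using pts[OF that] by (cases "i \<in> U") (auto simp: lattice_points_def)
  have y: "int (y i) = (\<Sum>x\<in>?F. int (g x) * x i)" for i
    unfolding y_def total_def using nonneg by (simp add: sum_nonneg)
  have supp_y: "nsupp y = U"
  proof -
    \<comment> \<open>Coordinates and weights are nonnegative, so nothing cancels.\<close>
    have "y i = 0 \<longleftrightarrow> (\<forall>x\<in>?F. int (g x) * x i = 0)" for i
      using finF nonneg y[of i] by (subst sum_nonneg_eq_0_iff[symmetric]) (auto simp flip: of_nat_eq_0_iff)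
    then show ?thesis by (auto simp: U_def supp_def nsupp_def)
  qed
  have "int (sum y U) = (\<Sum>x\<in>?F. int (g x) * sum x U)"
    by (simp add: y sum_distrib_left) (rule sum.swap)
  also have "\<dots> = (\<Sum>x\<in>?F. int (g x) * int r)"
    using pts by (intro sum.cong refl) (simp add: lattice_points_def)
  also have "\<dots> = int (r * n)"
    by (simp add: F(2)[symmetric] sum_distrib_left mult.commute)
  finally have sum_y: "sum y U = r * n" by (simp only: of_nat_eq_iff)
  then have mon: "y \<in> monomials C (r * n)"
    using U by (simp add: monomials_def supp_y)
  then show "total g \<in> monomials C (r * n)" by (simp add: y_def)
  let ?S = "?F \<union> nsupp (slice_count n y)"
  have finS: "finite ?S" using finF by (simp add: nsupp_slice_count)
  have le: "g x \<le> slice_count n y x" for x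
    using edgewise_weight_le[OF U(2) FU finF F(2) supp_y y, of x] by (cases "x \<in> ?F") (auto simp: nsupp_def)
  have "sum (slice_count n y) (nsupp (slice_count n y)) = n"
    using slice_count_monomial(1)[OF C n mon] by (simp add: monomials_def)
  then have "sum g ?S = sum (slice_count n y) ?S"
    using F(2) sum_nsupp[OF finS, of g] sum_nsupp[OF finS, of "slice_count n y"] by simp
  then have "g x = slice_count n y x" if "x \<in> ?S" for x
    using sum_mono_inv[of g ?S "slice_count n y" x] le that finS by blast
  moreover have "g x = slice_count n y x" if "x \<notin> ?S" for x
    using that by (simp add: nsupp_def)
  ultimately show "slice_count n (total g) = g"
    unfolding y_def[symmetric] by (intro ext) metis
qed

lemma monomials_0:
  fixes K :: "'a set set"
  assumes "{} \<in> K" "\<And>F. F \<in> K \<Longrightarrow> finite F"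
  shows "monomials K 0 = {\<lambda>_. 0}"
proof -
  have "y = (\<lambda>_. 0)" if "nsupp y \<in> K" "sum y (nsupp y) = 0" for y
  proof -
    have "\<forall>i\<in>nsupp y. y i = 0" using that assms(2) by simp
    then show ?thesis by (auto simp: nsupp_def)
  qed
  moreover have "nsupp (\<lambda>_ :: 'a. 0) = {}" by (simp add: nsupp_def)
  ultimately show ?thesis using assms(1) by (auto simp: monomials_def)
qed

lemma empty_in_edgewise_subdivision:
  assumes "simplicial_complex C"
  shows "{} \<in> edgewise_subdivision C r"
  using edgewise_subdivision_face[OF assms, of "{}" "{}"] assms
  by (simp add: edgewise_simplex_def simplicial_complex_def)

lemma card_monomials_edgewise:
  assumes C: "simplicial_complex C"
  shows "card (monomials (edgewise_subdivision C r) n) = card (monomials C (r * n))"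
proof (cases "n = 0")
  case True
  \<comment> \<open>Degree 0 is treated apart, since slicing divides by \<open>n\<close>.\<close>
  have "monomials C 0 = {\<lambda>_. 0}"
    using C by (intro monomials_0) (auto simp: simplicial_complex_def)
  moreover have "monomials (edgewise_subdivision C r) 0 = {\<lambda>_. 0}"
    using empty_in_edgewise_subdivision[OF C] finite_edgewise_subdivision(2)[OF C]
    by (intro monomials_0)
  ultimately show ?thesis using True by simp
next
  case False
  then have n: "0 < n" by simp
  have "bij_betw total (monomials (edgewise_subdivision C r) n) (monomials C (r * n))"
    by (rule bij_betw_byWitness[where f' = "slice_count n"])
      (use total_monomial[OF C n] slice_count_monomial[OF C n] in auto)
  then show ?thesis by (rule bij_betw_same_card)
qed

text \<open>The factor \<open>fps_X ^ (r - 1)\<close> cancels the offset of the section, leaving the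
  coefficients at multiples of \<open>r\<close>.\<close>

lemma hilbert_fps_edgewise:
  assumes "simplicial_complex C"
  shows "hilbert_fps (edgewise_subdivision C r) = fps_section r (fps_X ^ (r - 1) * hilbert_fps C)"
  by (rule fps_ext)
    (simp add: hilbert_fps_def fps_section_def fps_X_power_mult_nth card_monomials_edgewise[OF assms])

section \<open>Real-rootedness\<close>

text \<open>Nonreal zeros of a real polynomial come in conjugate pairs.\<close>

lemma real_rootedI:
  assumes "\<And>z. 0 < Im z \<Longrightarrow> cpoly p z \<noteq> 0"
  shows "real_rooted p"
proof -
  have "Im z = 0" if "cpoly p z = 0" for z
  proof (rule ccontr)
    assume "Im z \<noteq> 0"
    then have "0 < Im z \<or> 0 < Im (cnj z)" by auto
    then show False using assms[of z] assms[of "cnj z"] that by (auto simp: cpoly_cnj)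
  qed
  then show ?thesis by (auto simp: real_rooted_def complex_is_Real_iff)
qed

theorem theorem4p17:
  fixes C :: "'v::linorder set set" and d r :: nat
  assumes "simplicial_complex C"
    and "complex_dim C = int d"
    and "shellable C"
    and "r > d"
  shows "real_rooted (h_polynomial (edgewise_subdivision C r))"
proof (rule real_rootedI)
  fix z :: complex
  assume z: "0 < Im z"
  let ?K = "edgewise_subdivision C r" and ?W = "\<lambda>i. window_poly r d (r - 1 + i)"
  have r: "0 < r" using assms(4) by simp
  obtain J :: "nat set" and e where J: "finite J" "J \<noteq> {}" "\<forall>j\<in>J. e j \<le> Suc d"
    and C: "hilbert_fps C = (\<Sum>j\<in>J. fps_X ^ e j * geom ^ Suc d)"
    using hilbert_fps_shellable[OF assms(1-3)] by blast
  have K: "?K \<noteq> {}" "finite ?K" "\<And>F. F \<in> ?K \<Longrightarrow> finite F"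
    using empty_in_edgewise_subdivision[OF assms(1)] finite_edgewise_subdivision[OF assms(1)]
    by blast+
  let ?m = "Max (card ` ?K)"
  \<comment> \<open>The offset factor \<open>fps_X ^ (r - 1)\<close> and the shelling factor
    \<open>fps_X ^ e j\<close> merge into the window index \<open>r - 1 + e j\<close>.\<close>
  have hilb: "(1 - fps_X) ^ Suc d * hilbert_fps ?K = fps_of_poly (\<Sum>j\<in>J. ?W (e j))"
    unfolding hilbert_fps_edgewise[OF assms(1)] C fps_of_poly_sum fps_of_window_poly[OF r]
    by (simp only: sum_distrib_left fps_section_sum power_add mult.assoc)
  have hK: "fps_of_poly (h_polynomial ?K) = (1 - fps_X) ^ ?m * hilbert_fps ?K"
    using K by (intro fps_of_h_polynomial)
  have linear: "fps_of_poly [:1, -1:] = (1 - fps_X :: real fps)"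
    by (simp add: fps_of_poly_linear')
  \<comment> \<open>The factors \<open>1 - X\<close> have no zero in the upper half plane, so the dimension of the
    subdivision need not be known.\<close>
  have "fps_of_poly ([:1, -1:] ^ Suc d * h_polynomial ?K) =
      fps_of_poly ([:1, -1:] ^ ?m * (\<Sum>j\<in>J. ?W (e j)))"
    unfolding fps_of_poly_mult fps_of_poly_power linear hK
      hilb[symmetric] by (rule mult.left_commute)
  then have "[:1, -1:] ^ Suc d * h_polynomial ?K = [:1, -1:] ^ ?m * (\<Sum>j\<in>J. ?W (e j))"
    by (simp only: fps_of_poly_eq_iff)
  then have "cpoly ([:1, -1:] ^ Suc d * h_polynomial ?K) z =
      cpoly ([:1, -1:] ^ ?m * (\<Sum>j\<in>J. ?W (e j))) z"
    by (rule arg_cong)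
  then have "(1 - z) ^ Suc d * cpoly (h_polynomial ?K) z =
      (1 - z) ^ ?m * (\<Sum>j\<in>J. cpoly (?W (e j)) z)"
    by (simp only: cpoly_mult cpoly_linear_power cpoly_sum)
  \<comment> \<open>By \<open>e j \<le> d + 1 \<le> r\<close> all indices lie in the single period
    that starts at \<open>r - 1\<close>.\<close>
  moreover have "(\<Sum>j\<in>J. cpoly (?W (e j)) z) \<noteq> 0"
    using J assms(4)
    by (intro turning_sum_nonzero[OF window_poly_turning[OF z r] z, where b = "r - 1"]) auto
  moreover have "1 - z \<noteq> 0" using z by auto
  ultimately show "cpoly (h_polynomial ?K) z \<noteq> 0" by auto
qed

end
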